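(* Let $d\ge 3$ be an integer, let $G$ be a graph of maximum degree $d$, and let $M$ be an induced matching of $G$ produced by applying Local Search to $G$. Let $f$ and $g$ be real numbers such that $c_G(xy)\geq f$ and $n_{xy}\geq g$ for every edge $xy$ of $G$. Then the following statements hold. (i) $\sum\limits_{xy\in M}pc_G(M,xy)\leq (4d^2-1-2f-6g)|M|+\sum\limits_{xy\in M}m_{xy}$. (ii) $|M|\geq \dfrac{m(G)}{3d^2-d-f-\left(\frac{d+6}{2}\right)g}$.
   Context: Graphs are finite, simple, and undirected; $V(G)$, $E(G)$ are the vertex and edge sets and $m(G)=|E(G)|$. $N_G(u)$ is the neighborhood of $u$. A set $M\subseteq E(G)$ is an induced matching of $G$ if the subgraph of $G$ induced by the set of vertices incident with edges in $M$ is $1$-regular (the empty set is an induced matching). For a set $X\subseteq V(G)$, $m_G(X)$ is the number of edges of the subgraph of $G$ induced by $X$. For an edge $xy$ of $G$, $n_{xy}=|N_G(x)\cap N_G(y)|$ and $m_{xy}=m_G\big((N_G(x)\cup N_G(y))\setminus\{x,y\}\big)$. For an edge $e$ of $G$, $C_G(e)=\{f\in E(G):\mathrm{dist}_{L(G)}(e,f)\leq 2\}$, where $L(G)$ is the line graph of $G$ (so $C_G(e)$ consists of $e$, all edges sharing a vertex with $e$, and all edges joined to $e$ by an edge of $G$), and $c_G(e)=|C_G(e)|$. For a set $M$ of edges and $e\in M$, $PC_G(M,e)=C_G(e)\setminus\bigcup_{f\in M\setminus\{e\}}C_G(f)$ and $pc_G(M,e)=|PC_G(M,e)|$. Local Search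 is the following algorithm on input $G$: start with $M=\emptyset$ and repeat the following iteration: (1) if $M\cup\{e\}$ is an induced matching of $G$ for some edge $e\in E(G)\setminus M$, replace $M$ by $M\cup\{e\}$; (2) if $(M\setminus\{e\})\cup\{e',e''\}$ is an induced matching of $G$ for some three distinct edges $e\in M$ and $e',e''\in E(G)\setminus M$, replace $M$ by $(M\setminus\{e\})\cup\{e',e''\}$. The choices are arbitrary. Stop when $|M|$ does not increase during one iteration (i.e. neither (1) nor (2) is possible), and return $M$. *)

theory Defs
  imports Complex_Main "HOL-Library.Extended_Nat"
begin

record 'a ugraph =
  verts :: "'a set"
  edges :: "'a set set"

definition simple_graph :: "'a ugraph \<Rightarrow> bool" where
  "simple_graph G \<longleftrightarrow> finite (verts G) \<and> (\<forall>e \<in> edges G. e \<subseteq> verts G \<and> card e = 2)"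

definition num_edges :: "'a ugraph \<Rightarrow> nat" where
  "num_edges G = card (edges G)"

definition neighborhood :: "'a ugraph \<Rightarrow> 'a \<Rightarrow> 'a set" where
  "neighborhood G u = {v. {u, v} \<in> edges G}"

definition degree :: "'a ugraph \<Rightarrow> 'a \<Rightarrow> nat" where
  "degree G u = card (neighborhood G u)"

(* The graph without vertices gets maximum degree 0; Max of the empty set would be unspecified. *)
definition max_degree :: "'a ugraph \<Rightarrow> nat" where
  "max_degree G = Max (insert 0 (degree G ` verts G))"

definition regular :: "nat \<Rightarrow> 'a ugraph \<Rightarrow> bool" where
  "regular k G \<longleftrightarrow> (\<forall>v \<in> verts G. degree G v = k)"

definition induced_subgraph :: "'a ugraph \<Rightarrow> 'a set \<Rightarrow> 'a ugraph" where
  "induced_subgraph G X =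
     \<lparr> verts = verts G \<inter> X, edges = {e \<in> edges G. e \<subseteq> X} \<rparr>"

definition induced_matching :: "'a ugraph \<Rightarrow> 'a set set \<Rightarrow> bool" where
  "induced_matching G M \<longleftrightarrow>
     M \<subseteq> edges G \<and> regular 1 (induced_subgraph G (\<Union>M))"

definition line_graph :: "'a ugraph \<Rightarrow> 'a set ugraph" where
  "line_graph G =
     \<lparr> verts = edges G,
       edges = {{e, f} | e f. e \<in> edges G \<and> f \<in> edges G \<and> e \<noteq> f \<and> e \<inter> f \<noteq> {}} \<rparr>"

definition adj_rel :: "'a ugraph \<Rightarrow> ('a \<times> 'a) set" where
  "adj_rel G = {(u, v). {u, v} \<in> edges G}"

(* Length of a shortest walk between two vertices; \<infinity> (the infimum of the empty set)
   if they lie in different components. *)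
definition graph_dist :: "'a ugraph \<Rightarrow> 'a \<Rightarrow> 'a \<Rightarrow> enat" where
  "graph_dist G u v = Inf {enat n | n. (u, v) \<in> adj_rel G ^^ n}"

definition C_set :: "'a ugraph \<Rightarrow> 'a set \<Rightarrow> 'a set set" where
  "C_set G e = {f \<in> edges G. graph_dist (line_graph G) e f \<le> 2}"

definition c_num :: "'a ugraph \<Rightarrow> 'a set \<Rightarrow> nat" where
  "c_num G e = card (C_set G e)"

definition PC_set :: "'a ugraph \<Rightarrow> 'a set set \<Rightarrow> 'a set \<Rightarrow> 'a set set" where
  "PC_set G M e = C_set G e - (\<Union>f \<in> M - {e}. C_set G f)"

definition pc_num :: "'a ugraph \<Rightarrow> 'a set set \<Rightarrow> 'a set \<Rightarrow> nat" where
  "pc_num G M e = card (PC_set G M e)"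

(* For an edge e = {x, y}: the number of common neighbours of x and y. *)
definition n_edge :: "'a ugraph \<Rightarrow> 'a set \<Rightarrow> nat" where
  "n_edge G e = card (\<Inter>x \<in> e. neighborhood G x)"

(* For an edge e = {x, y}: the number of edges induced by (N(x) \<union> N(y)) - {x, y}. *)
definition m_edge :: "'a ugraph \<Rightarrow> 'a set \<Rightarrow> nat" where
  "m_edge G e = num_edges (induced_subgraph G ((\<Union>x \<in> e. neighborhood G x) - e))"

definition add_move :: "'a ugraph \<Rightarrow> 'a set set \<Rightarrow> 'a set set \<Rightarrow> bool" where
  "add_move G M M' \<longleftrightarrow>
     (\<exists>e \<in> edges G - M. M' = M \<union> {e} \<and> induced_matching G M')"

definition swap_move :: "'a ugraph \<Rightarrow> 'a set set \<Rightarrow> 'a set set \<Rightarrow> bool" where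
  "swap_move G M M' \<longleftrightarrow>
     (\<exists>e \<in> M. \<exists>e' \<in> edges G - M. \<exists>e'' \<in> edges G - M.
        e \<noteq> e' \<and> e \<noteq> e'' \<and> e' \<noteq> e'' \<and>
        M' = (M - {e}) \<union> {e', e''} \<and> induced_matching G M')"

(* Make some move of the given kind if there is one, otherwise change nothing. *)
definition try_move :: "('s \<Rightarrow> 's \<Rightarrow> bool) \<Rightarrow> 's \<Rightarrow> 's \<Rightarrow> bool" where
  "try_move R s s' \<longleftrightarrow> (if \<exists>t. R s t then R s s' else s' = s)"

definition ls_iteration :: "'a ugraph \<Rightarrow> 'a set set \<Rightarrow> 'a set set \<Rightarrow> bool" where
  "ls_iteration G M M' \<longleftrightarrow>
     (\<exists>N. try_move (add_move G) M N \<and> try_move (swap_move G) N M')"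

inductive ls_reachable :: "'a ugraph \<Rightarrow> 'a set set \<Rightarrow> bool" for G where
  start: "ls_reachable G {}"
| iterate: "ls_reachable G M \<Longrightarrow> ls_iteration G M M' \<Longrightarrow> card M < card M' \<Longrightarrow> ls_reachable G M'"

(* M is the result of some run of Local Search; the choices of moves are arbitrary. *)
definition local_search_output :: "'a ugraph \<Rightarrow> 'a set set \<Rightarrow> bool" where
  "local_search_output G M \<longleftrightarrow>
     (\<exists>N. ls_reachable G N \<and> ls_iteration G N M \<and> \<not> card N < card M)"

end

theory Submission
  imports Defs
begin

text \<open>
  Call two edges conflicting if they are joined by an edge, where each edge is joined to itself and
  to the edges that it meets. Then \<open>C_G(e)\<close> is the set of edges that conflict with \<open>e\<close>
  (\<open>C_set_iff\<close>), and an induced matching is a set of pairwise non-conflicting edges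
  (\<open>induced_matching_iff\<close>). A set \<open>M\<close> returned by Local Search admits no further
  move. Because no edge can be added, every edge conflicts with some edge of \<open>M\<close>; because
  no edge can be exchanged for two, any two private edges of the same \<open>e \<in> M\<close> conflict
  with each other.

  Summing degrees over \<open>X = (N(x) \<union> N(y)) - {x, y}\<close> counts the edges inside \<open>X\<close>
  twice, which gives \<open>c(xy) + m\<^sub>x\<^sub>y + d n\<^sub>x\<^sub>y \<le> 2 d\<^sup>2 - 2 d + 1\<close> (\<open>c_num_le\<close>). Read
  backwards, a lower bound on \<open>c\<close> limits how dense the surroundings of \<^emph>\<open>every\<close> edge are.

  For part (i), fix \<open>xy \<in> M\<close>. Its private edges are \<open>xy\<close>, at most \<open>2 (d - 1)\<close> other
  edges at \<open>x\<close> or \<open>y\<close>, at most \<open>m\<^sub>x\<^sub>y\<close> edges inside \<open>X\<close>, and edges leading from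
  \<open>N(x)\<close> or from \<open>N(y)\<close> to the outside of \<open>N(x) \<union> N(y)\<close>. Consider those that start in
  \<open>N(x)\<close>. Their outer ends are pairwise non-adjacent: an edge between two of them would
  conflict with no edge of \<open>M\<close>. So if two such edges \<open>uv\<close> and \<open>u'v'\<close> conflict and
  \<open>u\<close>, \<open>u'\<close> are distinct and non-adjacent, then \<open>uv'\<close> or \<open>u'v\<close> is an edge, and the
  outer neighbourhoods of \<open>u\<close> and \<open>u'\<close> are nested. Take \<open>u\<close> with the largest outer
  neighbourhood, of size \<open>k\<close>. The private edges starting in \<open>u\<close> or in one of the
  \<open>n\<^sub>x\<^sub>u\<close> common neighbours of \<open>x\<close> and \<open>u\<close> number at most \<open>k (1 + n\<^sub>x\<^sub>u)\<close>, and all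
  others have both ends in \<open>N(x) \<union> N(u)\<close> and so are counted by \<open>m\<^sub>x\<^sub>u\<close>. The bound on
  \<open>c(xu) + m\<^sub>x\<^sub>u\<close> then leaves at most \<open>2 d\<^sup>2 - d - c(xu) - 3 n\<^sub>x\<^sub>u\<close> such edges
  (\<open>conflicting_bipartite_bound\<close>). Adding the two sides gives (i), edge by edge
  (\<open>pc_num_le\<close>).

  For part (ii), every edge lies in one of the sets \<open>C_G(e)\<close> with \<open>e \<in> M\<close>; if it lies in only one, it is
  private. Hence \<open>2 m(G)\<close> is at most the sum of all \<open>c_G(e) + pc_G(M, e)\<close>
  (\<open>two_num_edges_le\<close>). In this sum the terms \<open>m\<^sub>x\<^sub>y\<close> from (i) cancel against those in the
  bound on \<open>c_G\<close>.
\<close>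

text \<open>
  Since every vertex of an edge is adjacent to the other one, two edges that coincide or
  share a vertex are \<open>near\<close> as well.
\<close>

definition near :: "'a ugraph \<Rightarrow> 'a set \<Rightarrow> 'a set \<Rightarrow> bool" where
  "near G e f \<longleftrightarrow> (\<exists>a\<in>e. \<exists>b\<in>f. {a, b} \<in> edges G)"

section \<open>Simple graphs\<close>

lemma simple_graph_finite_edges:
  assumes "simple_graph G" shows "finite (edges G)"
proof (rule finite_subset)
  show "edges G \<subseteq> Pow (verts G)" using assms by (auto simp: simple_graph_def)
  show "finite (Pow (verts G))" using assms by (auto simp: simple_graph_def)
qed

lemma edge_endpoints_neq:
  assumes "simple_graph G" "{a, b} \<in> edges G" shows "a \<noteq> b"
proof
  assume "a = b"
  then have "card {a, b} = 1" by simp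
  moreover have "card {a, b} = 2" using assms by (simp add: simple_graph_def)
  ultimately show False by simp
qed

lemma edgeE:
  assumes "simple_graph G" "e \<in> edges G"
  obtains a b where "e = {a, b}" "a \<noteq> b"
proof -
  have "card e = 2" using assms by (simp add: simple_graph_def)
  then show ?thesis using that by (auto simp: card_2_iff)
qed

lemma edge_other_endpoint:
  assumes "simple_graph G" "e \<in> edges G" "a \<in> e"
  obtains b where "e = {a, b}" "a \<noteq> b"
proof -
  obtain c c' where c: "e = {c, c'}" "c \<noteq> c'" using edgeE[OF assms(1,2)] .
  show ?thesis
  proof (cases "a = c")
    case True then show ?thesis using that[of c'] c by simp
  next
    case False
    then have "a = c'" using assms(3) c by simp
    then show ?thesis using that[of c] c by (simp add: insert_commute)
  qed
qed

lemma finite_neighborhood: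
  assumes "simple_graph G" shows "finite (neighborhood G v)"
proof (rule finite_subset)
  show "neighborhood G v \<subseteq> verts G" using assms by (auto simp: simple_graph_def neighborhood_def)
  show "finite (verts G)" using assms by (auto simp: simple_graph_def)
qed

lemma degree_le_max_degree:
  assumes "simple_graph G" shows "degree G v \<le> max_degree G"
proof (cases "v \<in> verts G")
  case True
  then show ?thesis using assms by (auto simp: max_degree_def simple_graph_def intro!: Max_ge)
next
  case False
  then have "neighborhood G v = {}" using assms by (auto simp: neighborhood_def simple_graph_def)
  then show ?thesis by (simp add: degree_def)
qed

lemma near_sym: "near G e f \<longleftrightarrow> near G f e"
proof -
  have "near G f e" if ef: "near G e f" for e f
  proof -
    obtain a b where ab: "a \<in> e" "b \<in> f" "{a, b} \<in> edges G" using ef by (auto simp: near_def)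
    then have "{b, a} \<in> edges G" by (simp add: insert_commute)
    then show ?thesis using ab unfolding near_def by blast
  qed
  then show ?thesis by blast
qed

lemma near_self:
  assumes "simple_graph G" "e \<in> edges G" shows "near G e e"
proof -
  obtain a b where "e = {a, b}" using edgeE[OF assms] .
  then show ?thesis using assms(2) by (auto simp: near_def)
qed

section \<open>Conflicting edges and induced matchings\<close>

text \<open>
  If \<open>vw\<close> joins \<open>e\<close> to a different \<open>f\<close>, then \<open>v\<close> and \<open>w\<close> have degree one in the induced
  subgraph only if \<open>vw\<close> is both \<open>e\<close> and \<open>f\<close>. Conversely, without such an edge the only
  matched neighbour of a matched vertex is its partner.
\<close>

lemma induced_matching_iff:
  assumes sg: "simple_graph G"
  shows "induced_matching G M \<longleftrightarrow>
    M \<subseteq> edges G \<and> (\<forall>e\<in>M. \<forall>f\<in>M. e \<noteq> f \<longrightarrow> \<not> near G e f)"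
proof (cases "M \<subseteq> edges G")
  case True
  let ?H = "induced_subgraph G (\<Union>M)"
  have vH: "v \<in> verts ?H \<longleftrightarrow> v \<in> \<Union>M" for v
    using True sg by (auto simp: induced_subgraph_def simple_graph_def)
  have NH: "neighborhood ?H v = {w. {v, w} \<in> edges G \<and> w \<in> \<Union>M}" if "v \<in> \<Union>M" for v
    using that by (auto simp: induced_subgraph_def neighborhood_def)
  have "regular 1 ?H \<longleftrightarrow> (\<forall>e\<in>M. \<forall>f\<in>M. e \<noteq> f \<longrightarrow> \<not> near G e f)"
  proof
    assume r: "regular 1 ?H"
    have uniq: "w = w'" if "v \<in> \<Union>M" "{v, w} \<in> edges G" "w \<in> \<Union>M" "{v, w'} \<in> edges G" "w' \<in> \<Union>M" for v w w'
    proof -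
      have "card (neighborhood ?H v) = 1" using r that(1) vH by (auto simp: regular_def degree_def)
      moreover have "w \<in> neighborhood ?H v" "w' \<in> neighborhood ?H v"
        using that NH by auto
      ultimately show ?thesis by (metis card_1_singletonE singletonD)
    qed
    show "\<forall>e\<in>M. \<forall>f\<in>M. e \<noteq> f \<longrightarrow> \<not> near G e f"
    proof (intro ballI impI notI)
      fix e f assume ef: "e \<in> M" "f \<in> M" "e \<noteq> f" "near G e f"
      then obtain v w where vw: "v \<in> e" "w \<in> f" "{v, w} \<in> edges G" by (auto simp: near_def)
      obtain v' where v': "e = {v, v'}" using edge_other_endpoint[OF sg subsetD[OF True ef(1)] vw(1)] .
      obtain w' where w': "f = {w, w'}" using edge_other_endpoint[OF sg subsetD[OF True ef(2)] vw(2)] .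
      have "v' = w" using uniq[of v v' w] vw ef v' w' True by blast
      moreover have "w' = v"
      proof -
        have "{w, w'} \<in> edges G" using ef w' True by blast
        moreover have "{w, v} \<in> edges G" using vw by (simp add: insert_commute)
        ultimately show ?thesis using uniq[of w w' v] vw ef w' by blast
      qed
      ultimately show False using v' w' ef(3) by auto
    qed
  next
    assume nn: "\<forall>e\<in>M. \<forall>f\<in>M. e \<noteq> f \<longrightarrow> \<not> near G e f"
    have "degree ?H v = 1" if v: "v \<in> \<Union>M" for v
    proof -
      obtain e where e: "e \<in> M" "v \<in> e" using v by blast
      obtain v' where v': "e = {v, v'}" "v \<noteq> v'" using edge_other_endpoint[OF sg subsetD[OF True e(1)] e(2)] .
      have "neighborhood ?H v = {v'}"
      proof (intro equalityI subsetI)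
        fix w assume "w \<in> neighborhood ?H v"
        then obtain f where f: "{v, w} \<in> edges G" "f \<in> M" "w \<in> f" using NH[OF v] by blast
        then have "near G e f" using e by (auto simp: near_def)
        then have "e = f" using nn e f by blast
        then show "w \<in> {v'}" using f v' edge_endpoints_neq[OF sg f(1)] by auto
      next
        fix w assume "w \<in> {v'}"
        then show "w \<in> neighborhood ?H v" using NH[OF v] v' e True by blast
      qed
      then show ?thesis by (simp add: degree_def)
    qed
    then show "regular 1 ?H" using vH by (auto simp: regular_def)
  qed
  then show ?thesis using True by (simp add: induced_matching_def)
qed (simp add: induced_matching_def)

lemma induced_matching_subset:
  assumes "simple_graph G" "induced_matching G M" "N \<subseteq> M" shows "induced_matching G N"
  using assms by (simp add: induced_matching_iff) blast

lemma induced_matching_insert: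
  assumes "simple_graph G" "induced_matching G M" "h \<in> edges G" "\<forall>e\<in>M. \<not> near G e h"
  shows "induced_matching G (insert h M)"
proof -
  have "\<forall>e\<in>M. \<not> near G h e" using assms(4) near_sym[of G h] by blast
  then show ?thesis using assms by (simp add: induced_matching_iff)
qed

lemma graph_dist_le_2_iff:
  "graph_dist L a b \<le> 2 \<longleftrightarrow>
     a = b \<or> (a, b) \<in> adj_rel L \<or> (a, b) \<in> adj_rel L O adj_rel L"
proof -
  let ?W = "{enat n | n. (a, b) \<in> adj_rel L ^^ n}"
  have "graph_dist L a b \<le> 2 \<longleftrightarrow> (\<exists>n\<le>2. (a, b) \<in> adj_rel L ^^ n)"
  proof
    assume *: "graph_dist L a b \<le> 2"
    have "Inf ?W \<noteq> \<infinity>"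
    proof
      assume "Inf ?W = \<infinity>"
      then show False using * by (simp add: graph_dist_def numeral_eq_enat)
    qed
    then have "?W \<noteq> {}" by (metis Inf_enat_def)
    then obtain k where "k \<in> ?W" by blast
    then have "Inf ?W \<in> ?W" by (rule wellorder_InfI)
    then obtain n where n: "Inf ?W = enat n" "(a, b) \<in> adj_rel L ^^ n" by blast
    moreover have "n \<le> 2" using * n(1) by (simp add: graph_dist_def numeral_eq_enat)
    ultimately show "\<exists>n\<le>2. (a, b) \<in> adj_rel L ^^ n" by blast
  next
    assume "\<exists>n\<le>2. (a, b) \<in> adj_rel L ^^ n"
    then obtain n where n: "n \<le> 2" "(a, b) \<in> adj_rel L ^^ n" by blast
    then have "Inf ?W \<le> enat n" by (intro Inf_lower) blast
    also have "\<dots> \<le> 2" using n by (simp add: numeral_eq_enat)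
    finally show "graph_dist L a b \<le> 2" by (simp add: graph_dist_def)
  qed
  also have "\<dots> \<longleftrightarrow> (\<exists>n\<in>{0, 1, 2}. (a, b) \<in> adj_rel L ^^ n)"
  proof -
    have "n \<le> 2 \<longleftrightarrow> n \<in> {0, 1, 2}" for n :: nat by auto
    then show ?thesis by blast
  qed
  also have "\<dots> \<longleftrightarrow> a = b \<or> (a, b) \<in> adj_rel L \<or> (a, b) \<in> adj_rel L O adj_rel L"
    by (simp add: numeral_2_eq_2)
  finally show ?thesis .
qed

lemma line_graph_adj_iff:
  "(e, f) \<in> adj_rel (line_graph G) \<longleftrightarrow>
     e \<in> edges G \<and> f \<in> edges G \<and> e \<noteq> f \<and> e \<inter> f \<noteq> {}"
  by (auto simp: adj_rel_def line_graph_def doubleton_eq_iff)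

text \<open>
  A path of length two in the line graph passes through an edge that meets both \<open>e\<close> and \<open>f\<close>;
  for disjoint \<open>e\<close> and \<open>f\<close> this edge joins them.
\<close>

lemma C_set_iff:
  assumes sg: "simple_graph G" and e: "e \<in> edges G"
  shows "f \<in> C_set G e \<longleftrightarrow> f \<in> edges G \<and> near G e f"
proof (cases "f \<in> edges G")
  case True
  have "graph_dist (line_graph G) e f \<le> 2 \<longleftrightarrow>
      e = f \<or> e \<inter> f \<noteq> {} \<or> (\<exists>h\<in>edges G. e \<noteq> h \<and> h \<noteq> f \<and> e \<inter> h \<noteq> {} \<and> h \<inter> f \<noteq> {})"
    unfolding graph_dist_le_2_iff relcomp_unfold by (simp add: line_graph_adj_iff e True) (use e True in blast)
  also have "\<dots> \<longleftrightarrow> near G e f"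
  proof
    assume *: "e = f \<or> e \<inter> f \<noteq> {} \<or>
      (\<exists>h\<in>edges G. e \<noteq> h \<and> h \<noteq> f \<and> e \<inter> h \<noteq> {} \<and> h \<inter> f \<noteq> {})"
    show "near G e f"
    proof (cases "e \<inter> f = {}")
      case False
      then obtain v where v: "v \<in> e" "v \<in> f" by blast
      obtain w where w: "e = {v, w}" using edge_other_endpoint[OF sg e v(1)] .
      then have "{w, v} \<in> edges G" using e by (simp add: insert_commute)
      then show ?thesis using v w unfolding near_def by blast
    next
      case disj: True
      obtain a b where "e = {a, b}" using edgeE[OF sg e] .
      then have "e \<noteq> f" using disj by auto
      then obtain h v w where h: "h \<in> edges G" "v \<in> e" "v \<in> h" "w \<in> f" "w \<in> h"
        using * disj by blast
      have "v \<noteq> w" using h disj by blast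
      have "h = {v, w}" using edge_other_endpoint[OF sg h(1) h(3)] h(5) \<open>v \<noteq> w\<close> by blast
      then show ?thesis using h unfolding near_def by blast
    qed
  next
    assume "near G e f"
    then obtain v w where vw: "v \<in> e" "w \<in> f" "{v, w} \<in> edges G" by (auto simp: near_def)
    show "e = f \<or> e \<inter> f \<noteq> {} \<or>
      (\<exists>h\<in>edges G. e \<noteq> h \<and> h \<noteq> f \<and> e \<inter> h \<noteq> {} \<and> h \<inter> f \<noteq> {})"
    proof (cases "e \<inter> f = {}")
      case True
      then have "e \<noteq> {v, w}" "{v, w} \<noteq> f" using vw by auto
      then show ?thesis using vw by (intro disjI2 bexI[of _ "{v, w}"]) auto
    qed simp
  qed
  finally show ?thesis using True by (simp add: C_set_def)
qed (simp add: C_set_def)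

lemma PC_set_iff:
  assumes sg: "simple_graph G" and M: "M \<subseteq> edges G" and e: "e \<in> M"
  shows "h \<in> PC_set G M e \<longleftrightarrow>
    h \<in> edges G \<and> near G e h \<and> (\<forall>f\<in>M - {e}. \<not> near G f h)"
proof -
  have "h \<in> C_set G f \<longleftrightarrow> h \<in> edges G \<and> near G f h" if "f \<in> M" for f
    using C_set_iff[OF sg] that M by blast
  then show ?thesis using e unfolding PC_set_def by blast
qed

section \<open>Counting the edges near a given edge\<close>

lemma sum_indicator_eq_card:
  "finite A \<Longrightarrow> (\<Sum>x\<in>A. if P x then 1 else 0) = card {x \<in> A. P x}"
  by (simp add: sum.inter_filter[symmetric])

text \<open>
  The degree sum over \<open>X\<close> counts an edge once for each of its ends in \<open>X\<close>, hence twice if it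
  lies inside \<open>X\<close>.
\<close>

lemma edges_meeting_le:
  assumes sg: "simple_graph G" and deg: "\<And>v. degree G v \<le> d" and X: "finite X"
  shows "card {h \<in> edges G. h \<inter> X \<noteq> {}} + card {h \<in> edges G. h \<subseteq> X} \<le> d * card X"
proof -
  have fE: "finite (edges G)" using simple_graph_finite_edges[OF sg] .
  have "card {h \<in> edges G. h \<inter> X \<noteq> {}} + card {h \<in> edges G. h \<subseteq> X}
      = (\<Sum>h\<in>edges G. (if h \<inter> X \<noteq> {} then 1 else 0) + (if h \<subseteq> X then 1 else 0))"
    using fE by (simp only: sum.distrib sum_indicator_eq_card)
  also have "\<dots> \<le> (\<Sum>h\<in>edges G. card (h \<inter> X))"
  proof (rule sum_mono)
    fix h assume h: "h \<in> edges G"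
    then have c2: "card h = 2" using sg by (auto simp: simple_graph_def)
    then have fh: "finite h" by (metis card.infinite zero_neq_numeral)
    show "(if h \<inter> X \<noteq> {} then 1 else 0) + (if h \<subseteq> X then 1 else 0) \<le> card (h \<inter> X)"
    proof (cases "h \<subseteq> X")
      case True then show ?thesis using c2 by (simp add: Int_absorb2)
    next
      case False
      then show ?thesis using fh by (auto simp: Suc_le_eq card_gt_0_iff)
    qed
  qed
  also have "\<dots> = (\<Sum>h\<in>edges G. \<Sum>v\<in>X. if v \<in> h then 1 else 0)"
    by (simp only: sum_indicator_eq_card[OF X]) (simp add: Int_def conj_commute)
  also have "\<dots> = (\<Sum>v\<in>X. \<Sum>h\<in>edges G. if v \<in> h then 1 else 0)" by (rule sum.swap)
  also have "\<dots> \<le> (\<Sum>v\<in>X. d)"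
  proof (rule sum_mono)
    fix v
    have "(\<Sum>h\<in>edges G. if v \<in> h then 1 else 0) = card {h \<in> edges G. v \<in> h}"
      using fE by (rule sum_indicator_eq_card)
    also have "\<dots> \<le> card ((\<lambda>w. {v, w}) ` neighborhood G v)"
    proof (rule card_mono)
      show "finite ((\<lambda>w. {v, w}) ` neighborhood G v)" using finite_neighborhood[OF sg] by blast
      show "{h \<in> edges G. v \<in> h} \<subseteq> (\<lambda>w. {v, w}) ` neighborhood G v"
      proof
        fix h assume "h \<in> {h \<in> edges G. v \<in> h}"
        then have h: "h \<in> edges G" "v \<in> h" by auto
        obtain w where w: "h = {v, w}" using edge_other_endpoint[OF sg h] .
        then show "h \<in> (\<lambda>w. {v, w}) ` neighborhood G v" using h by (auto simp: neighborhood_def)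
      qed
    qed
    also have "\<dots> \<le> degree G v"
      unfolding degree_def using card_image_le finite_neighborhood[OF sg] by blast
    also have "\<dots> \<le> d" by (rule deg)
    finally show "(\<Sum>h\<in>edges G. if v \<in> h then 1 else 0) \<le> d" .
  qed
  also have "\<dots> = d * card X" by simp
  finally show ?thesis .
qed

lemma n_edge_doubleton: "n_edge G {x, y} = card (neighborhood G x \<inter> neighborhood G y)"
  by (simp add: n_edge_def)

lemma m_edge_doubleton:
  "m_edge G {x, y} =
     card {h \<in> edges G. h \<subseteq> (neighborhood G x \<union> neighborhood G y) - {x, y}}"
  by (simp add: m_edge_def num_edges_def induced_subgraph_def)

text \<open>
  Each edge near \<open>xy\<close> other than \<open>xy\<close> meets \<open>X = (N(x) \<union> N(y)) - {x, y}\<close>, and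
  \<open>X\<close> has at most \<open>2 d - 2 - n\<^sub>x\<^sub>y\<close> vertices because common neighbours are counted twice in the degrees of \<open>x\<close>
  and \<open>y\<close>.
\<close>

lemma c_num_le:
  assumes sg: "simple_graph G" and deg: "\<And>v. degree G v \<le> d" and e: "e \<in> edges G"
  shows "c_num G e + m_edge G e + d * n_edge G e + 2 * d \<le> 2 * d\<^sup>2 + 1"
proof -
  obtain x y where xy: "e = {x, y}" "x \<noteq> y" using edgeE[OF sg e] .
  let ?N = "neighborhood G"
  define X where "X = (?N x \<union> ?N y) - {x, y}"
  have fin: "finite (?N v)" for v using finite_neighborhood[OF sg] .
  have fX: "finite X" using fin by (simp add: X_def)
  have sub: "{x, y} \<subseteq> ?N x \<union> ?N y" using e xy by (auto simp: neighborhood_def insert_commute)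
  have "?N x \<union> ?N y = X \<union> {x, y}" using sub X_def by blast
  moreover have "card (X \<union> {x, y}) = card X + card {x, y}"
    using fX by (intro card_Un_disjoint) (auto simp: X_def)
  ultimately have "card (?N x \<union> ?N y) = card X + 2" using xy by simp
  moreover have "card (?N x) + card (?N y) = card (?N x \<union> ?N y) + n_edge G e"
    using card_Un_Int[OF fin fin] xy by (simp add: n_edge_doubleton)
  moreover have "card (?N x) \<le> d" "card (?N y) \<le> d" using deg by (auto simp: degree_def)
  ultimately have "card X + 2 + n_edge G e \<le> 2 * d" by linarith
  then have "d * (card X + 2 + n_edge G e) \<le> d * (2 * d)" by (rule mult_le_mono2)
  then have dX: "d * card X + 2 * d + d * n_edge G e \<le> 2 * d\<^sup>2"
    by (simp add: algebra_simps power2_eq_square)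
  have "C_set G e \<subseteq> insert e {h \<in> edges G. h \<inter> X \<noteq> {}}"
  proof
    fix h assume "h \<in> C_set G e"
    then have h: "h \<in> edges G" "near G e h" using C_set_iff[OF sg e] by auto
    then obtain v where v: "v \<in> h" "v \<in> ?N x \<union> ?N y" using xy by (auto simp: near_def neighborhood_def)
    obtain w where w: "h = {v, w}" "v \<noteq> w" using edge_other_endpoint[OF sg h(1) v(1)] .
    have vw: "w \<in> ?N v" using h w by (simp add: neighborhood_def)
    have "h = e \<or> h \<inter> X \<noteq> {}"
    proof (cases "v \<in> {x, y}")
      case False then show ?thesis using v X_def by blast
    next
      case True
      then have "w \<in> ?N x \<union> ?N y" using vw by blast
      moreover have "h = e" if "w \<in> {x, y}" using that True w xy by auto
      ultimately show ?thesis using w X_def by blast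
    qed
    then show "h \<in> insert e {h \<in> edges G. h \<inter> X \<noteq> {}}" using h by blast
  qed
  then have "c_num G e \<le> card (insert e {h \<in> edges G. h \<inter> X \<noteq> {}})"
    unfolding c_num_def using simple_graph_finite_edges[OF sg] by (intro card_mono) auto
  also have "\<dots> \<le> Suc (card {h \<in> edges G. h \<inter> X \<noteq> {}})" by (rule card_insert_le_m1) auto
  finally have "c_num G e \<le> Suc (card {h \<in> edges G. h \<inter> X \<noteq> {}})" .
  moreover have "m_edge G e = card {h \<in> edges G. h \<subseteq> X}" using xy X_def by (simp add: m_edge_doubleton)
  ultimately show ?thesis using edges_meeting_le[OF sg deg fX] dX by linarith
qed

text \<open>
  This carries the argument. In the application \<open>K\<close> and \<open>L\<close> contain the inner and the
  outer ends of the private edges on the side of \<open>x\<close>. Let \<open>u \<in> K\<close> have the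
  most neighbours in \<open>L\<close>. For \<open>w \<in> K\<close> neither equal nor adjacent to \<open>u\<close>, a neighbour
  \<open>z \<in> L\<close> of \<open>w\<close> outside \<open>N(u)\<close> would force \<open>w\<close> to be adjacent to every neighbour of
  \<open>u\<close> in \<open>L\<close>, since \<open>L\<close> is independent; then \<open>w\<close> would beat \<open>u\<close>. So all edges at such
  \<open>w\<close> are counted by the term \<open>m\<close> of the edge \<open>xu\<close>. The witness \<open>h\<close> is \<open>xu\<close>, or
  \<open>xy\<close> if \<open>K\<close> is empty.
\<close>

lemma conflicting_bipartite_bound:
  assumes sg: "simple_graph G" and deg: "\<And>v. degree G v \<le> d" and d: "d \<ge> 3"
    and xy: "{x, y} \<in> edges G"
    and K: "K \<subseteq> neighborhood G x" and L: "L \<inter> neighborhood G x = {}" "x \<notin> L"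
    and conf: "\<And>u v u' v'. \<lbrakk>u \<in> K; v \<in> L; {u, v} \<in> edges G; u' \<in> K; v' \<in> L; {u', v'} \<in> edges G\<rbrakk>
      \<Longrightarrow> near G {u, v} {u', v'}"
    and ind: "\<And>v v'. \<lbrakk>v \<in> L; v' \<in> L\<rbrakk> \<Longrightarrow> {v, v'} \<notin> edges G"
  shows "\<exists>h\<in>edges G. card {q \<in> edges G. \<exists>u\<in>K. \<exists>v\<in>L. q = {u, v}}
           + c_num G h + 3 * n_edge G h + d \<le> 2 * d\<^sup>2"
proof (cases "K = {}")
  case True
  have "3 * n_edge G {x, y} \<le> d * n_edge G {x, y}" using d by simp
  then have "c_num G {x, y} + 3 * n_edge G {x, y} + d \<le> 2 * d\<^sup>2"
    using c_num_le[OF sg deg xy] d by linarith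
  then show ?thesis using True xy by auto
next
  case False
  let ?N = "neighborhood G"
  let ?k = "\<lambda>u. card (L \<inter> ?N u)"
  have fin: "finite (?N v)" for v using finite_neighborhood[OF sg] .
  have fK: "finite K" using K fin finite_subset by blast
  have "Max (?k ` K) \<in> ?k ` K" using fK False by (intro Max_in) auto
  then obtain u where u: "u \<in> K" and uM: "?k u = Max (?k ` K)" by force
  have umax: "?k w \<le> ?k u" if "w \<in> K" for w
    unfolding uM using fK that by (intro Max_ge) auto
  have xu: "{x, u} \<in> edges G" using u K by (auto simp: neighborhood_def)
  let ?Q = "{q \<in> edges G. \<exists>u\<in>K. \<exists>v\<in>L. q = {u, v}}"
  let ?F = "{h \<in> edges G. h \<subseteq> (?N x \<union> ?N u) - {x, u}}"
  let ?T = "insert u (?N x \<inter> ?N u \<inter> K)"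
  define n where "n = n_edge G {x, u}"
  have "?Q \<subseteq> (\<Union>w\<in>?T. (\<lambda>v. {w, v}) ` (L \<inter> ?N w)) \<union> ?F"
  proof
    fix q assume "q \<in> ?Q"
    then obtain w z where q: "q = {w, z}" "w \<in> K" "z \<in> L" "{w, z} \<in> edges G" by auto
    show "q \<in> (\<Union>w\<in>?T. (\<lambda>v. {w, v}) ` (L \<inter> ?N w)) \<union> ?F"
    proof (cases "w \<in> ?T")
      case True
      then show ?thesis using q by (auto simp: neighborhood_def)
    next
      case False
      then have wu: "w \<noteq> u" "{u, w} \<notin> edges G" using q K by (auto simp: neighborhood_def)
      have "z \<in> ?N u"
      proof (rule ccontr)
        assume z: "z \<notin> ?N u"
        have "insert z (L \<inter> ?N u) \<subseteq> L \<inter> ?N w"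
        proof
          fix v assume "v \<in> insert z (L \<inter> ?N u)"
          then consider "v = z" | "v \<in> L" "v \<in> ?N u" by blast
          then show "v \<in> L \<inter> ?N w"
          proof cases
            case 1 then show ?thesis using q by (simp add: neighborhood_def)
          next
            case 2
            then have "near G {u, v} {w, z}" using conf[of u v w z] u q by (simp add: neighborhood_def)
            moreover have "{v, z} \<notin> edges G" using ind 2 q by blast
            ultimately have "{v, w} \<in> edges G"
              using wu z by (auto simp: near_def neighborhood_def)
            then show ?thesis using 2 by (simp add: neighborhood_def insert_commute)
          qed
        qed
        then have "card (insert z (L \<inter> ?N u)) \<le> ?k w" using fin by (intro card_mono) auto
        then show False using umax[OF q(2)] z fin by simp
      qed
      moreover have "w \<in> ?N x" using q K by blast
      moreover have "w \<noteq> x" using \<open>w \<in> ?N x\<close> edge_endpoints_neq[OF sg, of x x] by (auto simp: neighborhood_def)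
      moreover have "z \<noteq> x" "z \<noteq> u" using q L u K by auto
      ultimately show ?thesis using q wu by blast
    qed
  qed
  then have "card ?Q \<le> card ((\<Union>w\<in>?T. (\<lambda>v. {w, v}) ` (L \<inter> ?N w)) \<union> ?F)"
    using fin simple_graph_finite_edges[OF sg] by (intro card_mono) auto
  also have "\<dots> \<le> card (\<Union>w\<in>?T. (\<lambda>v. {w, v}) ` (L \<inter> ?N w)) + card ?F" by (rule card_Un_le)
  also have "card (\<Union>w\<in>?T. (\<lambda>v. {w, v}) ` (L \<inter> ?N w)) \<le> (\<Sum>w\<in>?T. card ((\<lambda>v. {w, v}) ` (L \<inter> ?N w)))"
    using fin by (intro card_UN_le) auto
  also have "\<dots> \<le> (\<Sum>w\<in>?T. ?k u)"
  proof (rule sum_mono)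
    fix w assume "w \<in> ?T"
    then have "w \<in> K" using u by blast
    then show "card ((\<lambda>v. {w, v}) ` (L \<inter> ?N w)) \<le> ?k u"
      using umax card_image_le[of "L \<inter> ?N w" "\<lambda>v. {w, v}"] fin by (meson finite_Int le_trans)
  qed
  also have "\<dots> = card ?T * ?k u" by simp
  also have "\<dots> \<le> (n + 1) * ?k u"
  proof (rule mult_le_mono1)
    have "card ?T \<le> Suc (card (?N x \<inter> ?N u \<inter> K))" by (rule card_insert_le_m1) auto
    also have "card (?N x \<inter> ?N u \<inter> K) \<le> n"
      unfolding n_def n_edge_doubleton using fin by (intro card_mono) auto
    finally show "card ?T \<le> n + 1" by simp
  qed
  finally have Q: "card ?Q \<le> (n + 1) * ?k u + m_edge G {x, u}" by (simp add: m_edge_doubleton)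
  have "x \<in> ?N u" using xu by (simp add: neighborhood_def insert_commute)
  then have "card (insert x ((?N x \<inter> ?N u) \<union> (L \<inter> ?N u))) \<le> card (?N u)"
    by (intro card_mono[OF fin]) blast
  moreover have "card (insert x ((?N x \<inter> ?N u) \<union> (L \<inter> ?N u))) = Suc (n + ?k u)"
  proof -
    have "x \<notin> ?N x" using edge_endpoints_neq[OF sg, of x x] by (auto simp: neighborhood_def)
    then have "x \<notin> (?N x \<inter> ?N u) \<union> (L \<inter> ?N u)" using L by blast
    moreover have "card ((?N x \<inter> ?N u) \<union> (L \<inter> ?N u)) = n + ?k u"
      unfolding n_def n_edge_doubleton using fin L by (intro card_Un_disjoint) auto
    ultimately show ?thesis using fin by simp
  qed
  ultimately have "Suc (n + ?k u) \<le> d" using deg[of u] by (simp add: degree_def)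
  (* Let k be the number of neighbours of u in L. Because k \<le> d - 1 - n, the claim
     (n + 1) k + 3 n + 1 \<le> d n + d comes down to n \<le> n^2; writing d in terms of r avoids
     truncated subtraction. *)
  then obtain r where r: "d = Suc (n + ?k u) + r" using le_Suc_ex by blast
  have "(n + 1) * ?k u + 3 * n + 1 \<le> d * n + d"
  proof -
    have "n \<le> n * n" by simp
    then have "n \<le> r + (n * n + n * r)" by linarith
    then show ?thesis unfolding r by (simp add: algebra_simps)
  qed
  then have "card ?Q + c_num G {x, u} + 3 * n_edge G {x, u} + d \<le> 2 * d\<^sup>2"
    using Q c_num_le[OF sg deg xu] unfolding n_def[symmetric] by linarith
  then show ?thesis using xu by blast
qed

section \<open>Local optimality\<close>

text \<open>What remains of Local Search: its analysis depends only on the result admitting no move.\<close>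

definition no_move :: "'a ugraph \<Rightarrow> 'a set set \<Rightarrow> bool" where
  "no_move G M \<longleftrightarrow> (\<nexists>M'. add_move G M M') \<and> (\<nexists>M'. swap_move G M M')"

lemma add_move_card:
  assumes "finite M" "add_move G M M'" shows "card M' = Suc (card M)"
  using assms by (auto simp: add_move_def)

lemma swap_move_card:
  assumes "finite M" "swap_move G M M'" shows "card M' = Suc (card M)"
proof -
  have "M' = (M - {e}) \<union> {p, q} \<Longrightarrow> card M' = Suc (card M)"
    if *: "e \<in> M" "p \<in> edges G - M" "q \<in> edges G - M" "p \<noteq> q" for e p q
  proof -
    have "card (insert p (insert q (M - {e}))) = Suc (Suc (card (M - {e})))" using * assms(1) by simp
    also have "Suc (card (M - {e})) = card M" using assms(1) *(1) by (rule card_Suc_Diff1)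
    finally show "M' = (M - {e}) \<union> {p, q} \<Longrightarrow> card M' = Suc (card M)" by simp
  qed
  then show ?thesis using assms(2) by (auto simp only: swap_move_def)
qed

lemma ls_iteration_subset_edges:
  assumes "M \<subseteq> edges G" "ls_iteration G M M'" shows "M' \<subseteq> edges G"
proof -
  have closed: "B \<subseteq> edges G"
    if "A \<subseteq> edges G" "try_move R A B" "\<And>A B. R A B \<Longrightarrow> induced_matching G B" for R A B
    using that unfolding try_move_def induced_matching_def by metis
  obtain N where N: "try_move (add_move G) M N" "try_move (swap_move G) N M'"
    using assms(2) unfolding ls_iteration_def by blast
  have "N \<subseteq> edges G" using closed[OF assms(1) N(1)] by (auto simp: add_move_def)
  then show ?thesis using closed[OF _ N(2)] by (auto simp: swap_move_def)
qed

lemma ls_reachable_subset_edges: "ls_reachable G M \<Longrightarrow> M \<subseteq> edges G"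
  by (induction rule: ls_reachable.induct) (simp_all add: ls_iteration_subset_edges)

text \<open>
  Every move raises the cardinality by one, so in an iteration that does not raise it
  neither kind of move was possible, and the iteration leaves the set unchanged.
\<close>

lemma local_search_output_no_move:
  assumes sg: "simple_graph G" and out: "local_search_output G M"
  shows "no_move G M"
proof -
  obtain N where N: "ls_reachable G N" "ls_iteration G N M" "\<not> card N < card M"
    using out by (auto simp: local_search_output_def)
  have sub: "N \<subseteq> edges G" using ls_reachable_subset_edges[OF N(1)] .
  then have fN: "finite N" using simple_graph_finite_edges[OF sg] finite_subset by blast
  obtain A where A: "try_move (add_move G) N A" "try_move (swap_move G) A M"
    using N(2) by (auto simp: ls_iteration_def)
  have fA: "finite A"
    using A(1) fN by (auto simp: try_move_def add_move_def split: if_splits)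
  have le: "card A \<le> card M" "(\<exists>t. swap_move G A t) \<Longrightarrow> card A < card M"
    using A(2) swap_move_card[OF fA] by (auto simp: try_move_def split: if_splits)
  have "\<nexists>t. add_move G N t"
  proof
    assume "\<exists>t. add_move G N t"
    then have "add_move G N A" using A(1) by (auto simp: try_move_def)
    then show False using add_move_card[OF fN] le N(3) by fastforce
  qed
  moreover from this have "A = N" using A(1) by (auto simp: try_move_def split: if_splits)
  moreover have "\<nexists>t. swap_move G N t" using le(2) N(3) \<open>A = N\<close> by blast
  moreover from this have "M = N" using A(2) \<open>A = N\<close> by (auto simp: try_move_def split: if_splits)
  ultimately show ?thesis by (simp add: no_move_def)
qed

lemma no_move_dominating:
  assumes sg: "simple_graph G" and M: "induced_matching G M" and nm: "no_move G M"
    and h: "h \<in> edges G"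
  shows "\<exists>e\<in>M. near G e h"
proof (rule ccontr)
  assume *: "\<not> (\<exists>e\<in>M. near G e h)"
  then have "h \<notin> M" using near_self[OF sg h] by blast
  moreover have "induced_matching G (M \<union> {h})"
    using induced_matching_insert[OF sg M h] * by simp
  ultimately have "add_move G M (M \<union> {h})" using h by (auto simp: add_move_def)
  then show False using nm by (auto simp: no_move_def)
qed

text \<open>
  Two non-conflicting private edges of \<open>e\<close> would conflict with no edge of \<open>M - {e}\<close>, and could replace
  \<open>e\<close>.
\<close>

lemma no_move_private_near:
  assumes sg: "simple_graph G" and M: "induced_matching G M" and nm: "no_move G M" and e: "e \<in> M"
    and p: "p \<in> PC_set G M e" "q \<in> PC_set G M e"
  shows "near G p q"
proof (rule ccontr)
  assume pq: "\<not> near G p q"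
  have ME: "M \<subseteq> edges G" using M by (simp add: induced_matching_def)
  note pc = PC_set_iff[OF sg ME e]
  have pE: "p \<in> edges G" "near G e p" "\<forall>f\<in>M - {e}. \<not> near G f p"
    and qE: "q \<in> edges G" "near G e q" "\<forall>f\<in>M - {e}. \<not> near G f q"
    using p by (simp_all add: pc)
  have pp: "near G p p" and qq: "near G q q" using near_self[OF sg] pE(1) qE(1) by auto
  have neq: "p \<noteq> q" using pq pp by blast
  have pe: "p \<noteq> e" using pq qE(2) by blast
  have qe: "q \<noteq> e" using pq pE(2) near_sym[of G p q] by blast
  have pM: "p \<notin> M" using pE(3) pp pe by blast
  have qM: "q \<notin> M" using qE(3) qq qe by blast
  have im: "induced_matching G ((M - {e}) \<union> {p, q})"
  proof -
    have "induced_matching G (M - {e})" by (rule induced_matching_subset[OF sg M Diff_subset])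
    then have "induced_matching G (insert p (M - {e}))"
      using induced_matching_insert[OF sg _ pE(1,3)] by blast
    moreover have "\<forall>f\<in>insert p (M - {e}). \<not> near G f q" using qE(3) pq by simp
    ultimately have "induced_matching G (insert q (insert p (M - {e})))"
      using induced_matching_insert[OF sg _ qE(1)] by blast
    then show ?thesis by (simp add: insert_commute)
  qed
  have "swap_move G M ((M - {e}) \<union> {p, q})"
    unfolding swap_move_def
    by (rule bexI[of _ e], rule bexI[of _ p], rule bexI[of _ q])
      (simp_all only: e DiffI pE qE pM qM pe[symmetric] qe[symmetric] neq im not_False_eq_True)
  then show False using nm by (auto simp: no_move_def)
qed

text \<open>
  An edge is private for \<open>e\<close> exactly if it is near \<open>e\<close> and both its ends are free. As
  this is a condition on the two ends separately, any two free vertices that are joined by an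
  edge near \<open>e\<close> yield a private edge.
\<close>

definition free_vertices :: "'a ugraph \<Rightarrow> 'a set set \<Rightarrow> 'a set \<Rightarrow> 'a set" where
  "free_vertices G M e = {v. \<forall>f\<in>M - {e}. v \<notin> (\<Union>b\<in>f. neighborhood G b)}"

lemma PC_set_free_iff:
  assumes sg: "simple_graph G" and M: "M \<subseteq> edges G" and e: "e \<in> M"
  shows "h \<in> PC_set G M e \<longleftrightarrow> h \<in> edges G \<and> near G e h \<and> h \<subseteq> free_vertices G M e"
  unfolding PC_set_iff[OF assms] by (auto simp: free_vertices_def near_def neighborhood_def)

text \<open>An edge between the two vertices would conflict with no edge of \<open>M\<close>, so it could be added.\<close>

lemma free_outside_independent:
  assumes sg: "simple_graph G" and M: "induced_matching G M" and nm: "no_move G M" and e: "e \<in> M"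
    and v: "v \<in> free_vertices G M e" "v \<notin> (\<Union>b\<in>e. neighborhood G b)"
    and w: "w \<in> free_vertices G M e" "w \<notin> (\<Union>b\<in>e. neighborhood G b)"
  shows "{v, w} \<notin> edges G"
proof
  assume "{v, w} \<in> edges G"
  then obtain f where f: "f \<in> M" "near G f {v, w}" using no_move_dominating[OF sg M nm] by blast
  then show False using v w by (cases "f = e") (auto simp: free_vertices_def near_def neighborhood_def)
qed

text \<open>
  The private edges from \<open>N(x)\<close> to the outside of \<open>N(x) \<union> N(y)\<close> are exactly the edges
  between the free vertices of the two sets, which puts them in the reach of
  \<open>conflicting_bipartite_bound\<close>.
\<close>

lemma private_side_bound:
  assumes sg: "simple_graph G" and deg: "\<And>v. degree G v \<le> d" and d: "d \<ge> 3"
    and M: "induced_matching G M" and nm: "no_move G M" and e: "{x, y} \<in> M"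
    and N: "N = neighborhood G x \<union> neighborhood G y"
  shows "\<exists>h\<in>edges G. card {q \<in> PC_set G M {x, y}. \<exists>u\<in>neighborhood G x. \<exists>v. v \<notin> N \<and> q = {u, v}}
           + c_num G h + 3 * n_edge G h + d \<le> 2 * d\<^sup>2"
proof -
  let ?F = "free_vertices G M {x, y}"
  let ?K = "neighborhood G x \<inter> ?F" and ?L = "?F - N"
  have ME: "M \<subseteq> edges G" using M by (simp add: induced_matching_def)
  have xy: "{x, y} \<in> edges G" using e ME by blast
  have xN: "x \<in> N" using xy N by (auto simp: neighborhood_def insert_commute)
  note pc = PC_set_free_iff[OF sg ME e]
  have priv: "{u, v} \<in> PC_set G M {x, y}" if "u \<in> ?K" "v \<in> ?L" "{u, v} \<in> edges G" for u v
    using that unfolding pc by (auto simp: near_def neighborhood_def)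
  have "{q \<in> PC_set G M {x, y}. \<exists>u\<in>neighborhood G x. \<exists>v. v \<notin> N \<and> q = {u, v}}
      = {q \<in> edges G. \<exists>u\<in>?K. \<exists>v\<in>?L. q = {u, v}}"
  proof (intro equalityI subsetI)
    fix q assume "q \<in> {q \<in> PC_set G M {x, y}. \<exists>u\<in>neighborhood G x. \<exists>v. v \<notin> N \<and> q = {u, v}}"
    then obtain u v where q: "q \<in> PC_set G M {x, y}" "u \<in> neighborhood G x" "v \<notin> N" "q = {u, v}"
      by blast
    then have "q \<in> edges G" "u \<in> ?K" "v \<in> ?L" using pc[of q] by auto
    then show "q \<in> {q \<in> edges G. \<exists>u\<in>?K. \<exists>v\<in>?L. q = {u, v}}" using q(4) by blast
  next
    fix q assume "q \<in> {q \<in> edges G. \<exists>u\<in>?K. \<exists>v\<in>?L. q = {u, v}}"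
    then obtain u v where q: "u \<in> ?K" "v \<in> ?L" "{u, v} \<in> edges G" "q = {u, v}" by blast
    then show "q \<in> {q \<in> PC_set G M {x, y}. \<exists>u\<in>neighborhood G x. \<exists>v. v \<notin> N \<and> q = {u, v}}"
      using priv[OF q(1-3)] by blast
  qed
  moreover have "\<exists>h\<in>edges G. card {q \<in> edges G. \<exists>u\<in>?K. \<exists>v\<in>?L. q = {u, v}}
      + c_num G h + 3 * n_edge G h + d \<le> 2 * d\<^sup>2"
  proof (rule conflicting_bipartite_bound[OF sg deg d xy])
    show "?K \<subseteq> neighborhood G x" "?L \<inter> neighborhood G x = {}" "x \<notin> ?L" using N xN by auto
    show "near G {u, v} {u', v'}" if "u \<in> ?K" "v \<in> ?L" "{u, v} \<in> edges G" "u' \<in> ?K" "v' \<in> ?L" "{u', v'} \<in> edges G"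
      for u v u' v'
      using no_move_private_near[OF sg M nm e] priv that by blast
    show "{v, v'} \<notin> edges G" if "v \<in> ?L" "v' \<in> ?L" for v v'
      using free_outside_independent[OF sg M nm e, of v v'] that N by auto
  qed
  ultimately show ?thesis by simp
qed

lemma card_neighborhood_minus:
  assumes sg: "simple_graph G" and deg: "\<And>v. degree G v \<le> d" and xy: "{x, y} \<in> edges G"
  shows "card (neighborhood G x - {y}) + 1 \<le> d"
proof -
  have "y \<in> neighborhood G x" using xy by (simp add: neighborhood_def)
  then have "Suc (card (neighborhood G x - {y})) = card (neighborhood G x)"
    using finite_neighborhood[OF sg] by (metis card_Suc_Diff1)
  then show ?thesis using deg[of x] by (simp add: degree_def)
qed

text \<open>
  The edges \<open>h\<close> and \<open>h'\<close> come from the two sides \<open>N(x)\<close> and \<open>N(y)\<close>. Together with the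
  \<open>2 d - 1\<close> possible edges at \<open>x\<close> or \<open>y\<close> and those inside \<open>N(x) \<union> N(y)\<close>, the bounds
  for the two sides cover every private edge.
\<close>

lemma pc_num_le:
  assumes sg: "simple_graph G" and deg: "\<And>v. degree G v \<le> d" and d: "d \<ge> 3"
    and M: "induced_matching G M" and nm: "no_move G M" and e: "e \<in> M"
  shows "\<exists>h\<in>edges G. \<exists>h'\<in>edges G.
    pc_num G M e + c_num G h + c_num G h' + 3 * n_edge G h + 3 * n_edge G h' + 1
      \<le> 4 * d\<^sup>2 + m_edge G e"
proof -
  have ME: "M \<subseteq> edges G" using M by (simp add: induced_matching_def)
  obtain x y where exy: "e = {x, y}" "x \<noteq> y" using edgeE[OF sg] e ME by blast
  have xy: "{x, y} \<in> M" "{x, y} \<in> edges G" using e exy ME by auto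
  then have yx: "{y, x} \<in> M" "{y, x} \<in> edges G" by (auto simp: insert_commute)
  let ?N = "neighborhood G"
  define N where "N = ?N x \<union> ?N y"
  have N': "N = ?N y \<union> ?N x" using N_def by blast
  have xyN: "x \<in> N" "y \<in> N" using xy N_def by (auto simp: neighborhood_def insert_commute)
  have fE: "finite (edges G)" using simple_graph_finite_edges[OF sg] .
  have fin: "finite (?N v)" for v using finite_neighborhood[OF sg] .
  define P where "P = PC_set G M e"
  have PE: "P \<subseteq> edges G" using PC_set_iff[OF sg ME e] P_def by blast
  define Qx where "Qx = {q \<in> P. \<exists>u\<in>?N x. \<exists>v. v \<notin> N \<and> q = {u, v}}"
  define Qy where "Qy = {q \<in> P. \<exists>u\<in>?N y. \<exists>v. v \<notin> N \<and> q = {u, v}}"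
  define I where "I = {h \<in> edges G. h \<subseteq> N - {x, y}}"
  define Sx where "Sx = (\<lambda>a. {x, a}) ` (?N x - {y})"
  define Sy where "Sy = (\<lambda>a. {y, a}) ` (?N y - {x})"
  have "P \<subseteq> insert e (Sx \<union> Sy \<union> I \<union> Qx \<union> Qy)"
  proof
    fix h assume hP: "h \<in> P"
    then have h: "h \<in> edges G" "near G e h" using PC_set_iff[OF sg ME e] P_def by auto
    then obtain v where v: "v \<in> h" "v \<in> N" using exy N_def by (auto simp: near_def neighborhood_def)
    obtain w where w: "h = {v, w}" "v \<noteq> w" using edge_other_endpoint[OF sg h(1) v(1)] .
    consider "x \<in> h" | "y \<in> h" | "x \<notin> h" "y \<notin> h" by blast
    then show "h \<in> insert e (Sx \<union> Sy \<union> I \<union> Qx \<union> Qy)"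
    proof cases
      case 1
      obtain a where "h = {x, a}" using edge_other_endpoint[OF sg h(1) 1] .
      then show ?thesis using h exy unfolding Sx_def by (cases "a = y") (auto simp: neighborhood_def)
    next
      case 2
      obtain a where "h = {y, a}" using edge_other_endpoint[OF sg h(1) 2] .
      then show ?thesis using h exy unfolding Sy_def
        by (cases "a = x") (auto simp: neighborhood_def insert_commute)
    next
      case 3
      show ?thesis
      proof (cases "w \<in> N")
        case True
        then have "h \<in> I" using 3 v w h unfolding I_def by blast
        then show ?thesis by blast
      next
        case False
        then have "h \<in> Qx \<union> Qy" using hP v w unfolding Qx_def Qy_def N_def by blast
        then show ?thesis by blast
      qed
    qed
  qed
  moreover have fQ: "finite Sx" "finite Sy" "finite I" "finite Qx" "finite Qy"
    using fE fin finite_subset[OF PE] by (auto simp: Sx_def Sy_def I_def Qx_def Qy_def)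
  ultimately have "card P \<le> card (insert e (Sx \<union> Sy \<union> I \<union> Qx \<union> Qy))" by (intro card_mono) auto
  also have "\<dots> \<le> Suc (card (Sx \<union> Sy \<union> I \<union> Qx \<union> Qy))" by (rule card_insert_le_m1) auto
  also have "card (Sx \<union> Sy \<union> I \<union> Qx \<union> Qy) \<le> card Sx + card Sy + card I + card Qx + card Qy"
    by (meson add_le_mono card_Un_le le_refl le_trans)
  finally have P: "card P \<le> Suc (card Sx + card Sy + card I + card Qx + card Qy)" by simp
  have S: "card Sx + 1 \<le> d" "card Sy + 1 \<le> d"
    using card_neighborhood_minus[OF sg deg xy(2)] card_neighborhood_minus[OF sg deg yx(2)]
      card_image_le[of "?N x - {y}" "\<lambda>a. {x, a}"] card_image_le[of "?N y - {x}" "\<lambda>a. {y, a}"] fin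
    unfolding Sx_def Sy_def by (meson add_le_mono1 finite_Diff le_trans)+
  have I: "card I = m_edge G e" using exy by (simp add: I_def N_def m_edge_doubleton)
  obtain h where h: "h \<in> edges G" "card Qx + c_num G h + 3 * n_edge G h + d \<le> 2 * d\<^sup>2"
    using private_side_bound[OF sg deg d M nm xy(1) N_def] unfolding Qx_def P_def exy by blast
  have eyx: "e = {y, x}" using exy by blast
  obtain h' where h': "h' \<in> edges G" "card Qy + c_num G h' + 3 * n_edge G h' + d \<le> 2 * d\<^sup>2"
    using private_side_bound[OF sg deg d M nm yx(1) N'] unfolding Qy_def P_def eyx by blast
  have "card P + c_num G h + c_num G h' + 3 * n_edge G h + 3 * n_edge G h' + 1 \<le> 4 * d\<^sup>2 + m_edge G e"
    using P S I h(2) h'(2) by linarith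
  then show ?thesis using h(1) h'(1) by (auto simp: pc_num_def P_def)
qed

section \<open>Double counting over the matching\<close>

text \<open>
  An edge of \<open>G\<close> conflicts either with several edges of \<open>M\<close>, and is counted at least twice in
  the first sum, or with exactly one, and is counted once in each sum.
\<close>

lemma two_num_edges_le:
  assumes sg: "simple_graph G" and M: "induced_matching G M" and nm: "no_move G M"
  shows "2 * num_edges G \<le> (\<Sum>e\<in>M. c_num G e) + (\<Sum>e\<in>M. pc_num G M e)"
proof -
  have fE: "finite (edges G)" using simple_graph_finite_edges[OF sg] .
  have ME: "M \<subseteq> edges G" using M by (simp add: induced_matching_def)
  then have fM: "finite M" using fE finite_subset by blast
  let ?C = "\<lambda>h. {e \<in> M. h \<in> C_set G e}" and ?P = "\<lambda>h. {e \<in> M. h \<in> PC_set G M e}"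
  have count: "(\<Sum>e\<in>M. card (S e)) = (\<Sum>h\<in>edges G. card {e \<in> M. h \<in> S e})"
    if S: "\<And>e. S e \<subseteq> edges G" for S :: "'a set \<Rightarrow> 'a set set"
  proof -
    have "(\<Sum>e\<in>M. card (S e)) = (\<Sum>e\<in>M. card {h \<in> edges G. h \<in> S e})"
      using S by (intro sum.cong refl arg_cong[of _ _ card]) blast
    also have "\<dots> = (\<Sum>e\<in>M. \<Sum>h\<in>edges G. if h \<in> S e then 1 else 0)"
      using fE by (simp only: sum_indicator_eq_card)
    also have "\<dots> = (\<Sum>h\<in>edges G. \<Sum>e\<in>M. if h \<in> S e then 1 else 0)" by (rule sum.swap)
    also have "\<dots> = (\<Sum>h\<in>edges G. card {e \<in> M. h \<in> S e})"
      using fM by (simp only: sum_indicator_eq_card)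
    finally show ?thesis .
  qed
  have "2 * num_edges G = (\<Sum>h\<in>edges G. 2)" by (simp add: num_edges_def)
  also have "\<dots> \<le> (\<Sum>h\<in>edges G. card (?C h) + card (?P h))"
  proof (rule sum_mono)
    fix h assume h: "h \<in> edges G"
    obtain e where e: "e \<in> M" "near G e h" using no_move_dominating[OF sg M nm h] by blast
    then have eC: "e \<in> ?C h" using C_set_iff[OF sg] ME h by blast
    show "2 \<le> card (?C h) + card (?P h)"
    proof (cases "?C h = {e}")
      case True
      then have "e \<in> ?P h" unfolding PC_set_def by blast
      then have "card (?P h) > 0" using fM by (auto simp: card_gt_0_iff)
      then show ?thesis using True by simp
    next
      case False
      then obtain f where f: "f \<in> ?C h" "f \<noteq> e" using eC by blast
      have "card {e, f} \<le> card (?C h)" using eC f fM by (intro card_mono) auto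
      then show ?thesis using f by simp
    qed
  qed
  also have "\<dots> = (\<Sum>e\<in>M. c_num G e) + (\<Sum>e\<in>M. pc_num G M e)"
    unfolding sum.distrib c_num_def pc_num_def
    by (subst (1 2) count) (auto simp: C_set_def PC_set_def)
  finally show ?thesis .
qed

theorem theorem2:
  fixes G :: "'a ugraph" and M :: "'a set set" and d :: nat and f g :: real
  assumes "d \<ge> 3"
    and "simple_graph G"
    and "max_degree G = d"
    and "induced_matching G M"
    and "local_search_output G M"
    and "\<And>e. e \<in> edges G \<Longrightarrow> real (c_num G e) \<ge> f"
    and "\<And>e. e \<in> edges G \<Longrightarrow> real (n_edge G e) \<ge> g"
  shows "(\<Sum>e\<in>M. real (pc_num G M e))
           \<le> (4 * (real d)^2 - 1 - 2 * f - 6 * g) * real (card M) + (\<Sum>e\<in>M. real (m_edge G e))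
       \<and> real (card M)
           \<ge> real (num_edges G) / (3 * (real d)^2 - real d - f - ((real d + 6) / 2) * g)"
proof
  note sg = assms(2) and M = assms(4)
  have deg: "degree G v \<le> d" for v using degree_le_max_degree[OF sg] assms(3) by blast
  have nm: "no_move G M" using local_search_output_no_move[OF sg assms(5)] .
  have ME: "M \<subseteq> edges G" using M by (simp add: induced_matching_def)
  let ?p = "4 * (real d)^2 - 1 - 2 * f - 6 * g"
  let ?q = "2 * (real d)^2 - 2 * real d + 1 - real d * g"
  let ?D = "3 * (real d)^2 - real d - f - ((real d + 6) / 2) * g"
  have pc: "real (pc_num G M e) \<le> ?p + real (m_edge G e)" if eM: "e \<in> M" for e
  proof -
    obtain h h' where hh: "h \<in> edges G" "h' \<in> edges G" and
      le: "pc_num G M e + c_num G h + c_num G h' + 3 * n_edge G h + 3 * n_edge G h' + 1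
        \<le> 4 * d\<^sup>2 + m_edge G e"
      using pc_num_le[OF sg deg assms(1) M nm eM] by blast
    have "real (pc_num G M e + c_num G h + c_num G h' + 3 * n_edge G h + 3 * n_edge G h' + 1)
        \<le> real (4 * d\<^sup>2 + m_edge G e)"
      using le by (rule of_nat_mono)
    then show ?thesis using assms(6,7)[OF hh(1)] assms(6,7)[OF hh(2)] by simp
  qed
  have "(\<Sum>e\<in>M. real (pc_num G M e)) \<le> (\<Sum>e\<in>M. ?p + real (m_edge G e))"
    by (rule sum_mono) (rule pc)
  then show i: "(\<Sum>e\<in>M. real (pc_num G M e)) \<le> ?p * real (card M) + (\<Sum>e\<in>M. real (m_edge G e))"
    by (simp add: sum.distrib mult.commute)
  have c: "real (c_num G e) + real (m_edge G e) \<le> ?q" if "e \<in> M" for e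
  proof -
    have e: "e \<in> edges G" using that ME by blast
    have "real (c_num G e + m_edge G e + d * n_edge G e + 2 * d) \<le> real (2 * d\<^sup>2 + 1)"
      using c_num_le[OF sg deg e] by (rule of_nat_mono)
    moreover have "real d * g \<le> real d * real (n_edge G e)"
      using assms(7)[OF e] by (intro mult_left_mono) auto
    ultimately show ?thesis by simp
  qed
  have "(\<Sum>e\<in>M. real (c_num G e) + real (m_edge G e)) \<le> (\<Sum>e\<in>M. ?q)"
    by (rule sum_mono) (rule c)
  then have ii: "(\<Sum>e\<in>M. real (c_num G e)) + (\<Sum>e\<in>M. real (m_edge G e)) \<le> ?q * real (card M)"
    by (simp add: sum.distrib mult.commute)
  have "real (2 * num_edges G) \<le> real ((\<Sum>e\<in>M. c_num G e) + (\<Sum>e\<in>M. pc_num G M e))"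
    using two_num_edges_le[OF sg M nm] by (rule of_nat_mono)
  then have "2 * real (num_edges G) \<le> (?p + ?q) * real (card M)"
    using i ii by (simp add: algebra_simps)
  also have "?p + ?q = 2 * ?D" by (simp add: field_simps)
  finally have m: "real (num_edges G) \<le> real (card M) * ?D" by (simp only: mult.commute mult.assoc)
  show "real (card M) \<ge> real (num_edges G) / ?D"
  (* If ?D is zero, the quotient is zero by the convention for division by zero. *)
  proof (cases "?D > 0")
    case True
    then show ?thesis using m by (simp only: pos_divide_le_eq)
  next
    case False
    then have "real (num_edges G) / ?D \<le> 0" by (intro divide_nonneg_nonpos) auto
    then show ?thesis by (meson of_nat_0_le_iff order_trans)
  qed
qed

end
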